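(* Let $p,n\ge 2$ be integers with $p\le n$. Let $G=K_{2^{n-p},2^{n-p},\ldots,2^{n-p}}$ be the complete $2^p$-partite graph on $2^n$ vertices, labeled by $1,\ldots,2^n$ so that its parts are the residue classes modulo $2^p$. Let $H=ST_n^1$ be the $1$-rooted sibling tree, labeled by $1,\ldots,2^n$ according to the sibling tree traversal. Let $f:G\to H$ be the embedding that maps the vertex of $G$ labeled $x$ to the vertex of $H$ labeled $x$, for every $x$, and assigns to each edge $ab$ of $G$ a shortest path $P_f(ab)$ in $H$ between $f(a)$ and $f(b)$. Then $f$ has minimum wirelength among all embeddings of $G$ into $H$, and $$WL(G,H)=\frac12\sum_{j=1}^{n}\sum_{i=1}^{2^{n-j}} c_j+\frac12\sum_{j=1}^{n-1}\sum_{i=1}^{2^{n-j-1}} s_j+2^{n-p-1}(2^p-1),$$ where $$c_j=\begin{cases}(2^j-1)\bigl(2^{n-p}(2^p-1)-(2^j-2)\bigr), & j\le p,\\ (2^p-1)\bigl(2^{n-p}(2^j-1)-2^{j-p}(2^j-2)\bigr), & j>p,\end{cases}$$ $$s_j=\begin{cases}(2^{j+1}-2)\bigl(2^{n-p}(2^p-1)-(2^{j+1}-3)\bigr), & j+1\le p,\\ (2^p-1)\bigl(2^{n-p}(2^{j+1}-2)-2^{j-p+2}(2^j-2)\bigr)-2, & j+1>p.\end{cases}$$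
   Context: All graphs are finite and simple. An embedding $f$ of a graph $G$ into a graph $H$ is an injective map $f:V(G)\to V(H)$ together with, for each edge $e=xy$ of $G$, a path $P_f(e)$ in $H$ between $f(x)$ and $f(y)$ (not necessarily shortest). Its wirelength $WL_f(G,H)$ is the sum over $e\in E(G)$ of the length of $P_f(e)$; equivalently, $\sum_{e\in E(H)}EC_f(e)$, where $EC_f(e)$ is the number of edges $e'$ of $G$ such that $e$ lies on $P_f(e')$. The wirelength of $G$ into $H$ is $WL(G,H)=\min_f WL_f(G,H)$, over all embeddings $f$ of $G$ into $H$. The complete $2^p$-partite graph $K_{2^{n-p},\ldots,2^{n-p}}$ has its vertex set partitioned into $2^p$ independent sets (parts), each of size $2^{n-p}$, with all possible edges between vertices in different parts. The complete binary tree $T_n$ is the rooted binary tree with $n$ levels, level $i$ ($1\le i\le n$) containing $2^{i-1}$ vertices, in which each internal vertex has exactly two children (left and right) and all leaves are on level $n$; it has $2^n-1$ vertices. The $1$-rooted complete binary tree $T_n^1$ is obtained from $T_n$ by attaching a pendant edge to its root; the new vertex is the root of $T_n^1$ (level $0$). The $1$-rooted sibling tree $ST_n^1$ is obtained from $T_n^1$ by adding an edge (sibling edge) between the left and right children of each common parent; it has $2^n$ vertices. Sibling tree traversal: starting from the root, traverse the tree counterclockwise as in an ordinary binary tree traversal, but without cutting any region, i.e. traveling along sibling edges: from an internal vertex one goes down to the left child, around the left child's subtree, along the sibling edge to the right child, around the right child's subtree, and then back up to the internal vertex. Leaves are listed the first time they are passed and interior vertices the second time; thus, recursively, the left subtree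 is listed, then the right subtree, then the parent, and the root of $ST_n^1$ is listed last with label $2^n$. *)

theory Defs
  imports Complex_Main "HOL-Library.Disjoint_Sets"
begin

section \<open>Finite simple graphs, paths and embeddings\<close>

record 'v graph =
  verts :: "'v set"
  edges :: "'v set set"

definition simple_graph :: "'v graph \<Rightarrow> bool" where
  "simple_graph G \<longleftrightarrow> finite (verts G) \<and>
     (\<forall>e\<in>edges G. \<exists>u\<in>verts G. \<exists>v\<in>verts G. u \<noteq> v \<and> e = {u, v})"

text \<open>A path is the list of its vertices; its length is its number of edges.\<close>

definition is_path :: "'v graph \<Rightarrow> 'v list \<Rightarrow> bool" where
  "is_path H q \<longleftrightarrow> q \<noteq> [] \<and> distinct q \<and> set q \<subseteq> verts H \<and>
     successively (\<lambda>u v. {u, v} \<in> edges H) q"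

definition path_length :: "'v list \<Rightarrow> nat" where
  "path_length q = length q - 1"

text \<open>The ends are unordered: edges are undirected, so the list stored for an edge may run
  in either direction.\<close>

definition path_between :: "'v graph \<Rightarrow> 'v \<Rightarrow> 'v \<Rightarrow> 'v list \<Rightarrow> bool" where
  "path_between H x y q \<longleftrightarrow> is_path H q \<and> {hd q, last q} = {x, y}"

definition shortest_path_between :: "'v graph \<Rightarrow> 'v \<Rightarrow> 'v \<Rightarrow> 'v list \<Rightarrow> bool" where
  "shortest_path_between H x y q \<longleftrightarrow> path_between H x y q \<and>
     (\<forall>q'. path_between H x y q' \<longrightarrow> path_length q \<le> path_length q')"

definition embedding ::
  "'a graph \<Rightarrow> 'b graph \<Rightarrow> ('a \<Rightarrow> 'b) \<Rightarrow> ('a set \<Rightarrow> 'b list) \<Rightarrow> bool" where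
  "embedding G H f P \<longleftrightarrow> inj_on f (verts G) \<and> f ` verts G \<subseteq> verts H \<and>
     (\<forall>x y. {x, y} \<in> edges G \<longrightarrow> path_between H (f x) (f y) (P {x, y}))"

text \<open>The wirelength of an embedding depends on the vertex map only through the paths.\<close>

definition embedding_wirelength :: "'a graph \<Rightarrow> ('a set \<Rightarrow> 'b list) \<Rightarrow> nat" where
  "embedding_wirelength G P = (\<Sum>e\<in>edges G. path_length (P e))"

definition wirelength :: "'a graph \<Rightarrow> 'b graph \<Rightarrow> nat" where
  "wirelength G H = (LEAST w. \<exists>f P. embedding G H f P \<and> w = embedding_wirelength G P)"

section \<open>Complete multipartite graphs\<close>

definition complete_multipartite :: "'v graph \<Rightarrow> 'v set set \<Rightarrow> bool" where
  "complete_multipartite G Ps \<longleftrightarrow> partition_on (verts G) Ps \<and>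
     edges G = {{u, v} |u v. \<exists>A\<in>Ps. \<exists>B\<in>Ps. A \<noteq> B \<and> u \<in> A \<and> v \<in> B}"

lemma complete_multipartite_simple_graph:
  assumes "complete_multipartite G Ps" and "finite (verts G)"
  shows "simple_graph G"
proof -
  have part: "partition_on (verts G) Ps"
    and ed: "edges G = {{u, v} |u v. \<exists>A\<in>Ps. \<exists>B\<in>Ps. A \<noteq> B \<and> u \<in> A \<and> v \<in> B}"
    using assms(1) unfolding complete_multipartite_def by metis+
  have "\<exists>u\<in>verts G. \<exists>v\<in>verts G. u \<noteq> v \<and> e = {u, v}" if e: "e \<in> edges G" for e
  proof -
    obtain u v A B where uv: "e = {u, v}" "A \<in> Ps" "B \<in> Ps" "A \<noteq> B" "u \<in> A" "v \<in> B"
      using e unfolding ed by blast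
    have "A \<inter> B = {}"
      using part uv(2-4) unfolding partition_on_def disjoint_def by metis
    moreover have "u \<in> verts G" "v \<in> verts G"
      using part uv unfolding partition_on_def by blast+
    moreover have "u \<noteq> v"
      using \<open>A \<inter> B = {}\<close> uv(5,6) by blast
    ultimately show ?thesis using uv(1) by metis
  qed
  then show ?thesis using assms(2) unfolding simple_graph_def by metis
qed

section \<open>Binary trees and sibling trees\<close>

text \<open>A vertex of the complete binary tree is addressed by the list of turns leading to it from
  the root (\<open>False\<close> left, \<open>True\<close> right); a vertex of level \<open>i\<close> has an
  address of length \<open>i - 1\<close>.\<close>

definition complete_binary_tree :: "nat \<Rightarrow> bool list graph" where
  "complete_binary_tree n =
     \<lparr>verts = {w. length w < n},
      edges = {{w, w @ [b]} |w b. length w + 1 < n}\<rparr>"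

text \<open>The pendant vertex added in the 1-rooted tree is \<open>None\<close>.\<close>

definition rooted_binary_tree :: "nat \<Rightarrow> bool list option graph" where
  "rooted_binary_tree n =
     \<lparr>verts = insert None (Some ` verts (complete_binary_tree n)),
      edges = insert {None, Some []} ((`) Some ` edges (complete_binary_tree n))\<rparr>"

definition rooted_sibling_tree :: "nat \<Rightarrow> bool list option graph" where
  "rooted_sibling_tree n =
     \<lparr>verts = verts (rooted_binary_tree n),
      edges = edges (rooted_binary_tree n) \<union>
        {{Some (w @ [False]), Some (w @ [True])} |w. length w + 1 < n}\<rparr>"

text \<open>\<open>subtree_traversal h w\<close> lists the vertices of the subtree with \<open>h\<close> levels rooted
  at \<open>w\<close>.\<close>

fun subtree_traversal :: "nat \<Rightarrow> bool list \<Rightarrow> bool list list" where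
  "subtree_traversal 0 w = []"
| "subtree_traversal (Suc h) w =
     subtree_traversal h (w @ [False]) @ subtree_traversal h (w @ [True]) @ [w]"

definition sibling_traversal :: "nat \<Rightarrow> bool list option list" where
  "sibling_traversal n = map Some (subtree_traversal n []) @ [None]"

text \<open>Labels start at 1.\<close>

definition sibling_tree_vertex :: "nat \<Rightarrow> nat \<Rightarrow> bool list option" where
  "sibling_tree_vertex n k = sibling_traversal n ! (k - 1)"

lemma finite_short_bool_lists: "finite {w :: bool list. length w < n}"
proof -
  have "{w :: bool list. length w < n} \<subseteq> {w. set w \<subseteq> UNIV \<and> length w \<le> n}"
    by auto
  then show ?thesis
    by (rule finite_subset) (rule finite_lists_length_le, simp)
qed

lemma rooted_sibling_tree_simple_graph:
  assumes "n \<ge> 1"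
  shows "simple_graph (rooted_sibling_tree n)"
proof -
  let ?H = "rooted_sibling_tree n"
  have V: "verts ?H = insert None (Some ` {w. length w < n})"
    by (simp add: rooted_sibling_tree_def rooted_binary_tree_def complete_binary_tree_def)
  have "\<exists>u\<in>verts ?H. \<exists>v\<in>verts ?H. u \<noteq> v \<and> e = {u, v}" if "e \<in> edges ?H" for e
  proof -
    from that consider "e = {None, Some []}"
      | w b where "length w + 1 < n" "e = {Some w, Some (w @ [b])}"
      | w where "length w + 1 < n" "e = {Some (w @ [False]), Some (w @ [True])}"
      by (auto simp: rooted_sibling_tree_def rooted_binary_tree_def complete_binary_tree_def)
    then show ?thesis
    proof cases
      case 1
      moreover have "None \<in> verts ?H" "Some [] \<in> verts ?H"
        using assms by (auto simp: V)
      ultimately show ?thesis by blast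
    next
      case (2 w b)
      moreover have "Some w \<in> verts ?H" "Some (w @ [b]) \<in> verts ?H" "Some w \<noteq> Some (w @ [b])"
        using 2(1) by (simp_all add: V)
      ultimately show ?thesis by metis
    next
      case (3 w)
      moreover have "Some (w @ [False]) \<in> verts ?H" "Some (w @ [True]) \<in> verts ?H"
          "Some (w @ [False]) \<noteq> Some (w @ [True])"
        using 3(1) by (simp_all add: V)
      ultimately show ?thesis by metis
    qed
  qed
  then show ?thesis
    using finite_short_bool_lists[of n] by (simp add: simple_graph_def V)
qed

lemma set_subtree_traversal:
  "set (subtree_traversal h w) = (@) w ` {v. length v < h}"
proof (induction h arbitrary: w)
  case (Suc h)
  have "{v :: bool list. length v < Suc h} =
    (#) False ` {v. length v < h} \<union> (#) True ` {v. length v < h} \<union> {[]}"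
    (is "?L = ?R")
  proof
    show "?L \<subseteq> ?R"
    proof
      fix v :: "bool list"
      assume "v \<in> ?L"
      then show "v \<in> ?R"
        by (cases v; cases "hd v") auto
    qed
  qed auto
  then have "(@) w ` {v. length v < Suc h} =
    (@) (w @ [False]) ` {v. length v < h} \<union> (@) (w @ [True]) ` {v. length v < h} \<union> {w}"
    by (simp add: image_Un image_image)
  then show ?case
    by (simp only: subtree_traversal.simps set_append list.set Suc Un_assoc)
qed simp

lemma distinct_subtree_traversal: "distinct (subtree_traversal h w)"
  by (induction h arbitrary: w) (auto simp: set_subtree_traversal)

lemma length_subtree_traversal: "length (subtree_traversal h w) = 2 ^ h - 1"
proof (induction h arbitrary: w)
  case (Suc h)
  have "(1::nat) \<le> 2 ^ h" by simp
  then show ?case by (simp add: Suc)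
qed simp

lemma bij_betw_sibling_tree_vertex:
  "bij_betw (sibling_tree_vertex n) {1..2 ^ n} (verts (rooted_sibling_tree n))"
proof -
  let ?l = "sibling_traversal n"
  have "distinct ?l"
    by (auto simp: sibling_traversal_def distinct_map distinct_subtree_traversal)
  moreover have len: "length ?l = 2 ^ n"
    by (simp add: sibling_traversal_def length_subtree_traversal)
  moreover have "set ?l = verts (rooted_sibling_tree n)"
    by (auto simp: sibling_traversal_def set_subtree_traversal rooted_sibling_tree_def
        rooted_binary_tree_def complete_binary_tree_def)
  ultimately have "bij_betw ((!) ?l) {..<2 ^ n} (verts (rooted_sibling_tree n))"
    by (intro bij_betw_nth) auto
  moreover have "bij_betw (\<lambda>k. k - 1) {1..2 ^ n} {..<(2::nat) ^ n}"
    by (rule bij_betw_byWitness[where f' = Suc]) auto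
  ultimately have "bij_betw ((!) ?l \<circ> (\<lambda>k. k - 1)) {1..2 ^ n} (verts (rooted_sibling_tree n))"
    using bij_betw_trans by blast
  then show ?thesis
    by (simp add: sibling_tree_vertex_def[abs_def] comp_def)
qed

section \<open>The terms of the wirelength formula\<close>

definition c_term :: "nat \<Rightarrow> nat \<Rightarrow> nat \<Rightarrow> real" where
  "c_term n p j =
     (if j \<le> p then (2 ^ j - 1) * (2 ^ (n - p) * (2 ^ p - 1) - (2 ^ j - 2))
      else (2 ^ p - 1) * (2 ^ (n - p) * (2 ^ j - 1) - 2 ^ (j - p) * (2 ^ j - 2)))"

definition s_term :: "nat \<Rightarrow> nat \<Rightarrow> nat \<Rightarrow> real" where
  "s_term n p j =
     (if j + 1 \<le> p then (2 ^ (j + 1) - 2) * (2 ^ (n - p) * (2 ^ p - 1) - (2 ^ (j + 1) - 3))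
      else (2 ^ p - 1) *
        (2 ^ (n - p) * (2 ^ (j + 1) - 2) - 2 ^ (j - p + 2) * (2 ^ j - 2)) - 2)"

end

theory Submission
  imports Defs "HOL-Library.Sublist"
begin

text \<open>
  Consider the following cuts of the sibling tree: for every vertex \<open>w\<close> other than the pendant one, split
  off the subtree rooted at \<open>w\<close>; for every internal \<open>w\<close>, split off the union of the two subtrees
  below \<open>w\<close>; and count the cut at the root of the binary tree twice. Every edge of the tree then crosses
  exactly two cuts (\<open>card_separating_edge\<close>), and a shortest path crosses no cut twice
  (\<open>ex_geodesic\<close>). So twice the length of a path is at least the number of cuts that separate its ends,
  with equality for shortest paths (\<open>shortest_path_iff\<close>).

  Exchanging the order of summation, twice the wirelength of an embedding is at least the sum, over all
  cuts, of the number of edges of \<open>G\<close> that leave the preimage of the side of the cut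
  (\<open>sum_card_boundary_le\<close>); with shortest paths equality holds (\<open>sum_card_boundary_eq\<close>). The two
  graphs have equally many vertices, so the size of this preimage is the same for all embeddings. In a
  complete multipartite graph with parts of equal size, the boundary of a set of given size is an affine
  function of the sum of the squares of its intersections with the parts, so it is smallest for the sets
  spread evenly over the parts (\<open>balanced_boundary_le\<close>, \<open>balanced_boundary_eq\<close>).

  For the embedding \<open>f\<close> all cuts are optimal simultaneously: the side of each cut is a block of consecutive
  labels of the traversal (\<open>cut_interval\<close>), and a block of consecutive labels is spread evenly over
  the residue classes (\<open>card_residue_interval\<close>). The terms \<open>c_term\<close> and \<open>s_term\<close> are the minimal
  boundaries for the sizes \<open>2 ^ j - 1\<close> of a subtree and \<open>2 ^ (j + 1) - 2\<close> of a pair of sibling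
  subtrees, and the last summand of the formula is half the minimal boundary for the duplicated root cut,
  which separates a single vertex of \<open>G\<close> from the others.
\<close>

section \<open>Cuts of the sibling tree\<close>

text \<open>A cut is named by the part of the tree that it splits off. \<open>Branch w\<close> splits off the
  subtree rooted at \<open>w\<close>; \<open>Offspring w\<close> splits off the two subtrees below \<open>w\<close>
  together. \<open>Pendant\<close> has the same side as \<open>Branch []\<close>: the pendant edge lies on no
  triangle, and counting its cut twice gives every edge the same number of cuts, two.\<close>

datatype cut = Branch "bool list" | Offspring "bool list" | Pendant

fun side :: "cut \<Rightarrow> bool list option set" where
  "side (Branch w) = Some ` {v. prefix w v}"
| "side (Offspring w) = Some ` {v. strict_prefix w v}"
| "side Pendant = range Some"

lemma in_side_simps [simp]:
  "None \<notin> side c"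
  "Some v \<in> side (Branch w) \<longleftrightarrow> prefix w v"
  "Some v \<in> side (Offspring w) \<longleftrightarrow> strict_prefix w v"
  "Some v \<in> side Pendant"
  by (cases c) auto

declare side.simps [simp del]

definition cuts :: "nat \<Rightarrow> cut set" where
  "cuts n = Branch ` {w. length w < n} \<union> Offspring ` {w. length w + 1 < n} \<union> {Pendant}"

definition separating :: "nat \<Rightarrow> bool list option \<Rightarrow> bool list option \<Rightarrow> cut set" where
  "separating n x y = {c \<in> cuts n. (x \<in> side c) \<noteq> (y \<in> side c)}"

lemma finite_cuts: "finite (cuts n)"
proof -
  have "finite {w :: bool list. length w + 1 < n}"
    by (rule finite_subset[OF _ finite_short_bool_lists[of n]]) auto
  then show ?thesis
    using finite_short_bool_lists[of n] by (simp add: cuts_def)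
qed

lemma finite_separating: "finite (separating n x y)"
  using finite_cuts by (simp add: separating_def)

lemma separating_commute: "separating n x y = separating n y x"
  by (auto simp: separating_def)

lemma separating_doubleton:
  assumes "{x, y} = {x', y'}"
  shows "separating n x y = separating n x' y'"
  using assms separating_commute by (auto simp: doubleton_eq_iff)

lemma separating_refl: "separating n x x = {}"
  by (simp add: separating_def)

lemma verts_rooted_sibling_tree:
  "verts (rooted_sibling_tree n) = insert None (Some ` {w. length w < n})"
  by (simp add: rooted_sibling_tree_def rooted_binary_tree_def complete_binary_tree_def)

lemma edges_rooted_sibling_tree:
  "edges (rooted_sibling_tree n) = {{None, Some []}}
     \<union> {{Some w, Some (w @ [b])} |w b. length w + 1 < n}
     \<union> {{Some (w @ [False]), Some (w @ [True])} |w. length w + 1 < n}"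
proof -
  have "(`) Some ` {{w, w @ [b]} |w (b :: bool). length w + 1 < n}
      = {Some ` {w, w @ [b]} |w b. length w + 1 < n}"
    by blast
  also have "\<dots> = {{Some w, Some (w @ [b])} |w b. length w + 1 < n}"
    by (simp only: image_insert image_empty)
  finally have image: "(`) Some ` {{w, w @ [b]} |w (b :: bool). length w + 1 < n}
      = {{Some w, Some (w @ [b])} |w b. length w + 1 < n}" .
  show ?thesis
    unfolding rooted_sibling_tree_def rooted_binary_tree_def complete_binary_tree_def
      graph.simps image by (simp only: Un_insert_left Un_empty_left)
qed

lemma separating_pendant_edge:
  assumes "n \<ge> 1"
  shows "separating n None (Some []) = {Branch [], Pendant}"
  using assms by (auto simp: separating_def cuts_def)

lemma separating_tree_edge:
  assumes "length w + 1 < n"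
  shows "separating n (Some w) (Some (w @ [b])) = {Branch (w @ [b]), Offspring w}"
  using assms by (auto simp: separating_def cuts_def strict_prefix_def)

lemma separating_sibling_edge:
  assumes "length w + 1 < n"
  shows "separating n (Some (w @ [b])) (Some (w @ [\<not> b])) = {Branch (w @ [b]), Branch (w @ [\<not> b])}"
  using assms by (auto simp: separating_def cuts_def strict_prefix_def)

text \<open>An edge \<open>{w, wb}\<close> is crossed by the cuts \<open>Branch wb\<close> and \<open>Offspring w\<close>, a sibling edge by
  the branches at its two ends, and the pendant edge by the doubled root cut. This uniform count is what
  allows the length of a path to be compared with a number of cuts.\<close>

lemma card_separating_edge:
  assumes "n \<ge> 1" "{x, y} \<in> edges (rooted_sibling_tree n)"
  shows "card (separating n x y) = 2"
proof -
  consider "{x, y} = {None, Some []}"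
    | w b where "length w + 1 < n" "{x, y} = {Some w, Some (w @ [b])}"
    | w where "length w + 1 < n" "{x, y} = {Some (w @ [False]), Some (w @ [\<not> False])}"
    using assms(2) unfolding edges_rooted_sibling_tree by auto
  then show ?thesis
  proof cases
    case 1
    then show ?thesis
      by (simp add: separating_doubleton[OF 1] separating_pendant_edge[OF assms(1)])
  next
    case 2
    then show ?thesis
      by (simp add: separating_doubleton[OF 2(2)] separating_tree_edge)
  next
    case 3
    then show ?thesis
      unfolding separating_doubleton[OF 3(2)] separating_sibling_edge[OF 3(1)] by simp
  qed
qed

text \<open>From \<open>x\<close> one can always step towards \<open>y\<close> without crossing a cut that does not separate
  them: down if \<open>y\<close> lies below \<open>x\<close>, sideways if \<open>y\<close> lies in the subtree of the sibling of
  \<open>x\<close>, and up otherwise. Without the sibling edge the middle case would fail, since going up crosses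
  the offspring cut of the parent, which contains both ends.\<close>

lemma neighbour_towards:
  assumes "n \<ge> 1" and "x \<in> verts (rooted_sibling_tree n)" "y \<in> verts (rooted_sibling_tree n)"
    and "x \<noteq> y"
  obtains z where "{x, z} \<in> edges (rooted_sibling_tree n)" "separating n x z \<subseteq> separating n x y"
proof -
  let ?E = "edges (rooted_sibling_tree n)"
  have pendant: "{None, Some []} \<in> ?E"
    unfolding edges_rooted_sibling_tree by simp
  have child: "{Some w, Some (w @ [b])} \<in> ?E" if "length w + 1 < n" for w b
    unfolding edges_rooted_sibling_tree
    by (rule UnI1, rule UnI2) (intro CollectI exI[of _ w] exI[of _ b] conjI refl that)
  have sibling: "{Some (w @ [b]), Some (w @ [\<not> b])} \<in> ?E" if "length w + 1 < n" for w b
  proof -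
    have "{Some (w @ [False]), Some (w @ [True])} \<in> ?E"
      unfolding edges_rooted_sibling_tree
      by (intro UnI2 CollectI exI[of _ w] conjI refl that)
    then show ?thesis by (cases b) (simp_all add: insert_commute)
  qed
  have parent: "{Some (w @ [b]), Some w} \<in> ?E" if "length w + 1 < n" for w b
    using child[OF that, of b] by (simp add: insert_commute)
  have len: "length w < n" if "Some w \<in> verts (rooted_sibling_tree n)" for w
    using that by (auto simp: verts_rooted_sibling_tree)
  have up: "separating n (Some (w @ [b])) (Some w) = {Branch (w @ [b]), Offspring w}"
    if "length w + 1 < n" for w b
    using separating_tree_edge[OF that, of b] by (subst separating_commute)
  have "\<exists>z. {x, z} \<in> ?E \<and> separating n x z \<subseteq> separating n x y"
  proof (cases x)
    case None
    then obtain v where "y = Some v" using assms(4) by (cases y) auto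
    then have "separating n None (Some []) \<subseteq> separating n None y"
      unfolding separating_pendant_edge[OF assms(1)] using assms(1)
      by (auto simp: separating_def cuts_def)
    then show ?thesis unfolding None using pendant by (intro exI conjI)
  next
    case x: (Some u)
    then have "length u < n" using len assms(2) by simp
    show ?thesis
    proof (cases y)
      case y: None
      show ?thesis
      proof (cases u rule: rev_cases)
        case Nil
        have "{Some [], None} \<in> ?E" using pendant by (subst insert_commute)
        then show ?thesis unfolding x y Nil by (intro exI[of _ None] conjI subset_refl)
      next
        case (snoc w b)
        have l: "length w + 1 < n" using \<open>length u < n\<close> snoc by simp
        have "separating n (Some (w @ [b])) (Some w) \<subseteq> separating n (Some (w @ [b])) None"
          unfolding up[OF l] using l by (auto simp: separating_def cuts_def strict_prefix_def)
        then show ?thesis unfolding x y snoc using parent[OF l, of b] by (intro exI conjI)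
      qed
    next
      case y: (Some v)
      have uv: "u \<noteq> v" using assms(4) x y by simp
      show ?thesis
      proof (cases "prefix u v")
        case True
        then obtain v'' where v'': "v = u @ v''" by (rule prefixE)
        with uv obtain b v' where v: "v = u @ b # v'" by (cases v'') auto
        have l: "length u + 1 < n" using len[of v] assms(3) y v by simp
        have "separating n (Some u) (Some (u @ [b])) \<subseteq> separating n (Some u) (Some v)"
          unfolding separating_tree_edge[OF l] using l
          by (auto simp: separating_def cuts_def strict_prefix_def v)
        then show ?thesis unfolding x y using child[OF l, of b] by (intro exI conjI)
      next
        case False
        then obtain w b where u: "u = w @ [b]" by (cases u rule: rev_cases) auto
        have l: "length w + 1 < n" using \<open>length u < n\<close> u by simp
        have notu: "\<not> prefix (w @ [b]) v" using False u by simp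
        show ?thesis
        proof (cases "prefix (w @ [\<not> b]) v")
          case True
          with notu have "separating n (Some (w @ [b])) (Some (w @ [\<not> b]))
              \<subseteq> separating n (Some (w @ [b])) (Some v)"
            unfolding separating_sibling_edge[OF l] using l
            by (auto simp: separating_def cuts_def)
          then show ?thesis unfolding x y u using sibling[OF l, of b] by (intro exI conjI)
        next
          case other: False
          have "\<not> strict_prefix w v"
          proof
            assume "strict_prefix w v"
            then obtain a v' where "v = w @ a # v'" by (rule strict_prefixE')
            then show False using notu other by (cases "a = b") auto
          qed
          with notu have "separating n (Some (w @ [b])) (Some w)
              \<subseteq> separating n (Some (w @ [b])) (Some v)"
            unfolding up[OF l] using l strict_prefixI'[of "w @ [b]" w b "[]"]
            by (auto simp: separating_def cuts_def)
          then show ?thesis unfolding x y u using parent[OF l, of b] by (intro exI conjI)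
        qed
      qed
    qed
  qed
  then show thesis using that by blast
qed

section \<open>Distances as numbers of cuts\<close>

text \<open>Every cut separating the ends is crossed by some edge of the walk, and an edge
  crosses only two cuts.\<close>

lemma card_separating_le_walk:
  assumes "n \<ge> 1" "q \<noteq> []" "successively (\<lambda>u v. {u, v} \<in> edges (rooted_sibling_tree n)) q"
  shows "card (separating n (hd q) (last q)) \<le> 2 * path_length q"
  using assms(2,3)
proof (induction q rule: induct_list012)
  case (3 x z q)
  have "separating n x (last (z # q)) \<subseteq> separating n x z \<union> separating n z (last (z # q))"
    by (auto simp: separating_def)
  then have "card (separating n x (last (z # q)))
      \<le> card (separating n x z) + card (separating n z (last (z # q)))"
    by (meson card_Un_le card_mono finite_UnI finite_separating le_trans)
  also have "card (separating n x z) = 2"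
    using 3 assms(1) by (intro card_separating_edge) auto
  also have "card (separating n z (last (z # q))) \<le> 2 * path_length (z # q)"
    using 3 by simp
  finally show ?case by (simp add: path_length_def)
qed (auto simp: path_length_def separating_refl)

lemma path_length_Cons: "q \<noteq> [] \<Longrightarrow> path_length (x # q) = Suc (path_length q)"
  unfolding path_length_def by (cases q) simp_all

text \<open>Iterating \<open>neighbour_towards\<close> uses up two separating cuts per step, so the walk bound is
  attained. The last conjunct is carried along so that the walk has no repeated vertex: the number of cuts
  that separate the current vertex from \<open>y\<close> strictly decreases.\<close>

lemma ex_geodesic:
  assumes n: "n \<ge> 1" and y: "y \<in> verts (rooted_sibling_tree n)"
  shows "x \<in> verts (rooted_sibling_tree n) \<Longrightarrow>
    \<exists>q. is_path (rooted_sibling_tree n) q \<and> hd q = x \<and> last q = y \<and>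
      2 * path_length q = card (separating n x y) \<and>
      (\<forall>z\<in>set q. card (separating n z y) \<le> card (separating n x y))"
proof (induction "card (separating n x y)" arbitrary: x rule: less_induct)
  case less
  show ?case
  proof (cases "x = y")
    case True
    then show ?thesis
      using y by (intro exI[of _ "[x]"]) (simp add: is_path_def path_length_def separating_refl)
  next
    case False
    obtain z where z: "{x, z} \<in> edges (rooted_sibling_tree n)"
      and sub: "separating n x z \<subseteq> separating n x y"
      using neighbour_towards[OF n less.prems y False] .
    have "z \<in> verts (rooted_sibling_tree n)"
      using z rooted_sibling_tree_simple_graph[OF n] unfolding simple_graph_def
      by (metis insertCI insertE singletonD)
    moreover have "separating n z y = separating n x y - separating n x z"
      using sub by (auto simp: separating_def)
    then have card: "card (separating n x y) = card (separating n z y) + 2"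
      using card_separating_edge[OF n z] sub card_mono[OF finite_separating sub]
      by (simp add: card_Diff_subset finite_separating)
    ultimately obtain q where q: "is_path (rooted_sibling_tree n) q" "hd q = z" "last q = y"
        "2 * path_length q = card (separating n z y)"
        "\<forall>v\<in>set q. card (separating n v y) \<le> card (separating n z y)"
      using less.hyps[of z] by auto
    have "x \<notin> set q" using q(5) card by force
    then have "is_path (rooted_sibling_tree n) (x # q)"
      using q(1,2) z less.prems by (cases q) (auto simp: is_path_def)
    then show ?thesis
      using q card path_length_Cons[of q x]
      by (intro exI[of _ "x # q"]) (auto simp: is_path_def)
  qed
qed

lemma path_between_commute: "path_between H x y = path_between H y x"
  unfolding path_between_def by (subst insert_commute) (rule refl)

lemma shortest_path_between_commute:
  "shortest_path_between H x y = shortest_path_between H y x"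
  unfolding shortest_path_between_def fun_eq_iff
  by (subst (1 2) path_between_commute) (rule allI, rule refl)

lemma card_separating_le_path:
  assumes "n \<ge> 1" "path_between (rooted_sibling_tree n) x y q"
  shows "card (separating n x y) \<le> 2 * path_length q"
proof -
  have "card (separating n (hd q) (last q)) \<le> 2 * path_length q"
    using assms by (intro card_separating_le_walk) (auto simp: path_between_def is_path_def)
  moreover have "separating n (hd q) (last q) = separating n x y"
    using assms(2) by (intro separating_doubleton) (simp add: path_between_def)
  ultimately show ?thesis by simp
qed

text \<open>The distance of two vertices is half the number of cuts separating them.\<close>

lemma shortest_path_iff:
  assumes "n \<ge> 1" "x \<in> verts (rooted_sibling_tree n)" "y \<in> verts (rooted_sibling_tree n)"
  shows "shortest_path_between (rooted_sibling_tree n) x y q \<longleftrightarrow>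
    path_between (rooted_sibling_tree n) x y q \<and> 2 * path_length q = card (separating n x y)"
proof -
  obtain r where r: "path_between (rooted_sibling_tree n) x y r"
      "2 * path_length r = card (separating n x y)"
    using ex_geodesic[OF assms(1,3,2)] by (auto simp: path_between_def)
  show ?thesis
  proof
    assume q: "shortest_path_between (rooted_sibling_tree n) x y q"
    then have "path_between (rooted_sibling_tree n) x y q" "path_length q \<le> path_length r"
      using r(1) by (simp_all add: shortest_path_between_def)
    then show "path_between (rooted_sibling_tree n) x y q \<and> 2 * path_length q = card (separating n x y)"
      using card_separating_le_path[OF assms(1)] r(2) by force
  next
    assume q: "path_between (rooted_sibling_tree n) x y q \<and> 2 * path_length q = card (separating n x y)"
    have "path_length q \<le> path_length q'" if "path_between (rooted_sibling_tree n) x y q'" for q'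
      using card_separating_le_path[OF assms(1) that] q by linarith
    then show "shortest_path_between (rooted_sibling_tree n) x y q"
      using q by (simp add: shortest_path_between_def)
  qed
qed

lemma ex_shortest_path:
  assumes "n \<ge> 1" "x \<in> verts (rooted_sibling_tree n)" "y \<in> verts (rooted_sibling_tree n)"
  shows "\<exists>q. shortest_path_between (rooted_sibling_tree n) x y q"
proof -
  obtain q where "is_path (rooted_sibling_tree n) q" "hd q = x" "last q = y"
      "2 * path_length q = card (separating n x y)"
    using ex_geodesic[OF assms(1,3,2)] by blast
  then show ?thesis
    unfolding shortest_path_iff[OF assms] path_between_def by blast
qed

section \<open>Edge boundaries in complete multipartite graphs\<close>

definition boundary :: "'v graph \<Rightarrow> 'v set \<Rightarrow> 'v set set" where
  "boundary G S = {e \<in> edges G. e \<inter> S \<noteq> {} \<and> \<not> e \<subseteq> S}"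

lemma sum_card_parts:
  assumes "partition_on V Ps" "finite V" "S \<subseteq> V"
  shows "(\<Sum>A\<in>Ps. card (S \<inter> A)) = card S"
proof -
  have fin: "finite Ps"
    using assms(1,2) finite_elements by blast
  have "card (\<Union>A\<in>Ps. S \<inter> A) = (\<Sum>A\<in>Ps. card (S \<inter> A))"
    using assms fin finite_subset[OF assms(3,2)]
    by (intro card_UN_disjoint) (auto simp: partition_on_def disjoint_def)
  moreover have "(\<Union>A\<in>Ps. S \<inter> A) = S"
    using assms(1,3) by (auto simp: partition_on_def)
  ultimately show ?thesis by simp
qed

text \<open>A vertex of \<open>S \<inter> A\<close> sends boundary edges to all vertices outside \<open>S\<close> and outside
  \<open>A\<close>. Hence the boundary depends only on the size of \<open>S\<close> and on the sum of the squares of the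
  parts of \<open>S\<close>, and it is smallest when \<open>S\<close> is spread evenly.\<close>

lemma card_boundary:
  assumes G: "complete_multipartite G Ps" and fin: "finite (verts G)"
    and M: "\<And>A. A \<in> Ps \<Longrightarrow> card A = M" and S: "S \<subseteq> verts G"
  shows "int (card (boundary G S)) =
    int (card S) * (int (card (verts G)) - int (card S) - int M) + (\<Sum>A\<in>Ps. (int (card (S \<inter> A)))\<^sup>2)"
proof -
  let ?V = "verts G"
  define D where "D = (\<Union>A\<in>Ps. (S \<inter> A) \<times> (?V - S - A))"
  have part: "partition_on ?V Ps"
    and edges: "edges G = {{u, v} |u v. \<exists>A\<in>Ps. \<exists>B\<in>Ps. A \<noteq> B \<and> u \<in> A \<and> v \<in> B}"
    using G unfolding complete_multipartite_def by metis+
  have finPs: "finite Ps" using part fin finite_elements by blast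
  have sub: "A \<subseteq> ?V" if "A \<in> Ps" for A using part that by (auto simp: partition_on_def)
  have same: "A = B" if "A \<in> Ps" "B \<in> Ps" "u \<in> A" "u \<in> B" for A B u
    using part that by (auto simp: partition_on_def disjoint_def)
  have "boundary G S = (\<lambda>(u, v). {u, v}) ` D"
  proof (intro equalityI subsetI)
    fix e assume e: "e \<in> boundary G S"
    then obtain u v A B where uv: "e = {u, v}" "A \<in> Ps" "B \<in> Ps" "A \<noteq> B" "u \<in> A" "v \<in> B"
      unfolding boundary_def edges by blast
    have "u \<in> ?V - B" "v \<in> ?V - A" using uv sub same by blast+
    moreover have "(u \<in> S \<and> v \<notin> S) \<or> (v \<in> S \<and> u \<notin> S)"
      using e uv(1) by (auto simp: boundary_def)
    ultimately have "(u, v) \<in> D \<or> (v, u) \<in> D" using uv by (auto simp: D_def)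
    then show "e \<in> (\<lambda>(u, v). {u, v}) ` D"
      using uv(1) by (auto simp: insert_commute intro: rev_image_eqI)
  next
    fix e assume "e \<in> (\<lambda>(u, v). {u, v}) ` D"
    then obtain u v A where uv: "e = {u, v}" "A \<in> Ps" "u \<in> S" "u \<in> A" "v \<in> ?V" "v \<notin> S" "v \<notin> A"
      by (auto simp: D_def)
    moreover obtain B where "B \<in> Ps" "v \<in> B" using part uv(5) by (auto simp: partition_on_def)
    ultimately have "e \<in> edges G" unfolding edges by blast
    then show "e \<in> boundary G S" using uv by (auto simp: boundary_def)
  qed
  moreover have "inj_on (\<lambda>(u, v). {u, v}) D"
    by (auto simp: inj_on_def D_def doubleton_eq_iff)
  moreover have "card D = (\<Sum>A\<in>Ps. card (S \<inter> A) * card (?V - S - A))"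
  proof -
    have "finite (S \<inter> A)" "finite (?V - S - A)" for A
      using fin S finite_subset by blast+
    moreover have "((S \<inter> A) \<times> (?V - S - A)) \<inter> ((S \<inter> B) \<times> (?V - S - B)) = {}"
      if "A \<in> Ps" "B \<in> Ps" "A \<noteq> B" for A B
      using same[OF that(1,2)] that(3) by blast
    ultimately have "card D = (\<Sum>A\<in>Ps. card ((S \<inter> A) \<times> (?V - S - A)))"
      unfolding D_def using finPs by (intro card_UN_disjoint) blast+
    then show ?thesis by (simp add: card_cartesian_product)
  qed
  ultimately have "int (card (boundary G S)) = (\<Sum>A\<in>Ps. int (card (S \<inter> A)) * int (card (?V - S - A)))"
    by (simp add: card_image)
  also have "\<dots> = (\<Sum>A\<in>Ps. int (card (S \<inter> A)) * (int (card ?V) - int (card S) - int M)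
      + (int (card (S \<inter> A)))\<^sup>2)"
  proof (rule sum.cong[OF refl])
    fix A assume A: "A \<in> Ps"
    have finA: "finite A" and finS: "finite S" using sub[OF A] S fin finite_subset by blast+
    have "card ?V = card (?V - S - A) + card (S \<union> A)"
      using card_Diff_subset[of "S \<union> A" ?V] card_mono[of ?V "S \<union> A"] finA finS sub[OF A] S fin
      by (simp add: Diff_eq Int_assoc)
    moreover have "card S + M = card (S \<union> A) + card (S \<inter> A)"
      using card_Un_Int[OF finS finA] M[OF A] by simp
    ultimately have compl: "int (card (?V - S - A)) = int (card ?V) - int (card S) - int M + int (card (S \<inter> A))"
      by linarith
    show "int (card (S \<inter> A)) * int (card (?V - S - A)) =
        int (card (S \<inter> A)) * (int (card ?V) - int (card S) - int M) + (int (card (S \<inter> A)))\<^sup>2"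
      unfolding compl by (simp add: algebra_simps power2_eq_square)
  qed
  also have "\<dots> = int (\<Sum>A\<in>Ps. card (S \<inter> A)) * (int (card ?V) - int (card S) - int M)
      + (\<Sum>A\<in>Ps. (int (card (S \<inter> A)))\<^sup>2)"
    by (simp add: sum.distrib sum_distrib_right)
  finally show ?thesis by (simp add: sum_card_parts[OF part fin S])
qed

text \<open>The boundary of a set of \<open>k\<close> vertices that meets every part in \<open>q\<close> or \<open>q + 1\<close>
  vertices, in the graph with \<open>2 ^ p\<close> parts of size \<open>2 ^ (n - p)\<close>. The terms with \<open>q\<close> are the
  minimum of the sum of squares, written in the form that \<open>sum_squares_parts\<close> produces.\<close>

definition balanced_boundary :: "nat \<Rightarrow> nat \<Rightarrow> nat \<Rightarrow> int" where
  "balanced_boundary n p k = (let q = int (k div 2 ^ p) in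
     int k * (2 ^ n - int k - 2 ^ (n - p)) + (2 * q + 1) * int k - q * (q + 1) * 2 ^ p)"

text \<open>The remaining sum measures the imbalance: since \<open>(a - q) * (a - q - 1) \<ge> 0\<close> for integers
  \<open>a\<close> and \<open>q\<close>, with equality exactly for \<open>a = q\<close> and \<open>a = q + 1\<close>, this identity gives the
  minimum of the sum of squares together with the sets that attain it.\<close>

lemma sum_squares_parts:
  assumes "partition_on V Ps" "finite V" "S \<subseteq> V"
  shows "(\<Sum>A\<in>Ps. (int (card (S \<inter> A)))\<^sup>2) =
    (2 * q + 1) * int (card S) - q * (q + 1) * int (card Ps)
    + (\<Sum>A\<in>Ps. (int (card (S \<inter> A)) - q) * (int (card (S \<inter> A)) - q - 1))"
proof -
  have "(\<Sum>A\<in>Ps. (int (card (S \<inter> A)))\<^sup>2) = (\<Sum>A\<in>Ps. (2 * q + 1) * int (card (S \<inter> A)) - q * (q + 1)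
      + (int (card (S \<inter> A)) - q) * (int (card (S \<inter> A)) - q - 1))"
    by (intro sum.cong) (auto simp: algebra_simps power2_eq_square)
  also have "\<dots> = (2 * q + 1) * int (\<Sum>A\<in>Ps. card (S \<inter> A)) - q * (q + 1) * int (card Ps)
      + (\<Sum>A\<in>Ps. (int (card (S \<inter> A)) - q) * (int (card (S \<inter> A)) - q - 1))"
    by (simp add: sum.distrib sum_subtractf sum_distrib_left)
  finally show ?thesis by (simp add: sum_card_parts[OF assms])
qed

context
  fixes G :: "'a graph" and Ps n p S
  assumes G: "complete_multipartite G Ps" and fin: "finite (verts G)"
    and order: "card (verts G) = 2 ^ n" and num: "card Ps = 2 ^ p"
    and size: "\<And>A. A \<in> Ps \<Longrightarrow> card A = 2 ^ (n - p)" and S: "S \<subseteq> verts G"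
begin

private lemma card_boundary_eq:
  "int (card (boundary G S)) = balanced_boundary n p (card S)
    + (\<Sum>A\<in>Ps. (int (card (S \<inter> A)) - int (card S div 2 ^ p))
        * (int (card (S \<inter> A)) - int (card S div 2 ^ p) - 1))"
proof -
  have part: "partition_on (verts G) Ps" using G unfolding complete_multipartite_def by metis
  show ?thesis
    using card_boundary[OF G fin size S]
      sum_squares_parts[OF part fin S, of "int (card S div 2 ^ p)"]
    unfolding balanced_boundary_def Let_def order num by simp
qed

lemma balanced_boundary_le: "balanced_boundary n p (card S) \<le> int (card (boundary G S))"
proof -
  have "0 \<le> (a - q) * (a - q - 1)" for a q :: int
    by (cases "a \<le> q") (auto intro: mult_nonpos_nonpos mult_nonneg_nonneg)
  then show ?thesis unfolding card_boundary_eq by (simp add: sum_nonneg)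
qed

lemma balanced_boundary_eq:
  assumes "\<And>A. A \<in> Ps \<Longrightarrow> card (S \<inter> A) \<in> {card S div 2 ^ p, card S div 2 ^ p + 1}"
  shows "int (card (boundary G S)) = balanced_boundary n p (card S)"
proof -
  have zero: "\<forall>A\<in>Ps. (int (card (S \<inter> A)) - int (card S div 2 ^ p))
      * (int (card (S \<inter> A)) - int (card S div 2 ^ p) - 1) = 0"
  proof
    fix A assume "A \<in> Ps"
    from assms[OF this]
    show "(int (card (S \<inter> A)) - int (card S div 2 ^ p))
      * (int (card (S \<inter> A)) - int (card S div 2 ^ p) - 1) = 0"
      by (elim insertE emptyE) simp_all
  qed
  show ?thesis unfolding card_boundary_eq sum.neutral[OF zero] by simp
qed

end

lemma card_residue_below:
  fixes m r a :: nat
  assumes "r < m"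
  shows "card {x. x < a \<and> x mod m = r} = (a + (m - 1 - r)) div m"
proof (induction a)
  case 0
  then show ?case using assms by simp
next
  case (Suc a)
  have "Suc (a + (m - 1 - r)) mod m = 0 \<longleftrightarrow> a mod m = r"
  proof -
    have "Suc (a + (m - 1 - r)) = a + (m - r)" using assms by simp
    then have "Suc (a + (m - 1 - r)) mod m = (a mod m + (m - r)) mod m"
      by (simp only: mod_add_left_eq)
    moreover have "a mod m < m" using assms by simp
    ultimately show ?thesis
      using assms
      by (cases "a mod m" r rule: linorder_cases) (simp_all add: le_mod_geq)
  qed
  moreover have "{x. x < Suc a \<and> x mod m = r} =
      (if a mod m = r then insert a {x. x < a \<and> x mod m = r} else {x. x < a \<and> x mod m = r})"
    by (auto simp: less_Suc_eq)
  ultimately show ?case using Suc by (simp add: div_Suc)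
qed

text \<open>Intervals of labels are balanced with respect to the residue classes.\<close>

lemma card_residue_interval:
  fixes m r s k :: nat
  assumes "r < m"
  shows "card {x \<in> {s..<s + k}. x mod m = r} \<in> {k div m, k div m + 1}"
proof -
  let ?X = "{x. x < s \<and> x mod m = r}" and ?Y = "{x \<in> {s..<s + k}. x mod m = r}"
  have "card {x. x < s + k \<and> x mod m = r} = card (?X \<union> ?Y)"
    by (rule arg_cong[where f = card]) auto
  also have "\<dots> = card ?X + card ?Y"
    by (rule card_Un_disjoint) auto
  finally have "card {x. x < s + k \<and> x mod m = r} = card ?X + card ?Y" .
  then have "(s + k + (m - 1 - r)) div m = (s + (m - 1 - r)) div m + card ?Y"
    unfolding card_residue_below[OF assms] .
  moreover define b where "b = s + (m - 1 - r)"
  ultimately have "(b + k) div m = b div m + card ?Y"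
    by (simp only: ac_simps)
  then have "card ?Y = k div m + (b mod m + k mod m) div m"
    using div_add1_eq[of b k m] by linarith
  moreover have "(b mod m + k mod m) div m < 2"
  proof -
    have "b mod m < m" "k mod m < m" using assms by simp_all
    then have "b mod m + k mod m < 2 * m" by linarith
    then show ?thesis by (simp add: less_mult_imp_div_less)
  qed
  ultimately show ?thesis by auto
qed

section \<open>Cut sides as label intervals\<close>

fun cut_size :: "nat \<Rightarrow> cut \<Rightarrow> nat" where
  "cut_size n (Branch w) = 2 ^ (n - length w) - 1"
| "cut_size n (Offspring w) = 2 ^ (n - length w) - 2"
| "cut_size n Pendant = 2 ^ n - 1"

lemma subtree_traversal_infix:
  "length w \<le> h \<Longrightarrow>
    \<exists>xs ys. subtree_traversal h r = xs @ subtree_traversal (h - length w) (r @ w) @ ys"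
proof (induction w arbitrary: h r)
  case Nil
  then show ?case by (intro exI[of _ "[]"]) simp
next
  case (Cons b w)
  then obtain h' where h: "h = Suc h'" and le: "length w \<le> h'" by (cases h) auto
  obtain xs ys where IH: "subtree_traversal h' (r @ [b])
      = xs @ subtree_traversal (h' - length w) ((r @ [b]) @ w) @ ys"
    using Cons.IH[OF le] by blast
  show ?case
  proof (cases b)
    case True
    then show ?thesis using IH h
      by (intro exI[of _ "subtree_traversal h' (r @ [False]) @ xs"] exI[of _ "ys @ [r]"]) simp
  next
    case False
    then show ?thesis using IH h
      by (intro exI[of _ xs] exI[of _ "ys @ subtree_traversal h' (r @ [True]) @ [r]"]) simp
  qed
qed

text \<open>The traversal lists each subtree as a block, and within the block of \<open>w\<close> the two subtrees
  below \<open>w\<close> come directly before \<open>w\<close> itself. So the sides of all cuts, the offspring cuts included,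
  are blocks of the traversal.\<close>

lemma cut_infix:
  assumes "c \<in> cuts n"
  shows "\<exists>xs L ys. sibling_traversal n = xs @ L @ ys \<and>
    set L = side c \<inter> verts (rooted_sibling_tree n) \<and> length L = cut_size n c"
proof -
  consider w where "c = Branch w" "length w < n" | w where "c = Offspring w" "length w + 1 < n"
    | "c = Pendant"
    using assms by (auto simp: cuts_def)
  then show ?thesis
  proof cases
    case (1 w)
    obtain xs ys where "subtree_traversal n [] = xs @ subtree_traversal (n - length w) w @ ys"
      using subtree_traversal_infix[of w n "[]"] 1 by auto
    moreover have "set (map Some (subtree_traversal (n - length w) w))
        = side c \<inter> verts (rooted_sibling_tree n)"
      using 1 by (auto simp: set_subtree_traversal verts_rooted_sibling_tree side.simps prefix_def)
    ultimately show ?thesis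
      using 1
      by (intro exI[of _ "map Some xs"] exI[of _ "map Some (subtree_traversal (n - length w) w)"]
          exI[of _ "map Some ys @ [None]"])
        (simp add: sibling_traversal_def length_subtree_traversal)
  next
    case (2 w)
    obtain xs ys where tr: "subtree_traversal n [] = xs @ subtree_traversal (n - length w) w @ ys"
      using subtree_traversal_infix[of w n "[]"] 2 by auto
    obtain h where h: "n - length w = Suc h" using 2 by (cases "n - length w") auto
    let ?L = "subtree_traversal h (w @ [False]) @ subtree_traversal h (w @ [True])"
    have "set (subtree_traversal (Suc h) w) = insert w (set ?L)" by auto
    moreover have "w \<notin> set ?L" by (auto simp: set_subtree_traversal)
    ultimately have "set ?L = (@) w ` {v. length v < Suc h} - {w}"
      unfolding set_subtree_traversal[of "Suc h"] by blast
    also have "\<dots> = {u. strict_prefix w u \<and> length u < n}"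
    proof (intro equalityI subsetI)
      fix u assume "u \<in> {u. strict_prefix w u \<and> length u < n}"
      then have u: "prefix w u" "w \<noteq> u" "length u < n" by (auto simp: strict_prefix_def)
      then obtain v where "u = w @ v" by (auto elim: prefixE)
      then show "u \<in> (@) w ` {v. length v < Suc h} - {w}" using h u by auto
    qed (use h in \<open>auto simp: strict_prefix_def\<close>)
    finally have "set (map Some ?L) = Some ` {u. strict_prefix w u \<and> length u < n}"
      unfolding set_map by (rule arg_cong)
    also have "\<dots> = side c \<inter> verts (rooted_sibling_tree n)"
      unfolding 2(1) side.simps verts_rooted_sibling_tree by blast
    finally have "set (map Some ?L) = side c \<inter> verts (rooted_sibling_tree n)" .
    moreover have "length ?L = cut_size n c"
      using 2 h by (simp add: length_subtree_traversal)
    ultimately show ?thesis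
      using tr h
      by (intro exI[of _ "map Some xs"] exI[of _ "map Some ?L"] exI[of _ "Some w # map Some ys @ [None]"])
        (simp add: sibling_traversal_def)
  next
    case 3
    then show ?thesis
      by (intro exI[of _ "[]"] exI[of _ "map Some (subtree_traversal n [])"] exI[of _ "[None]"])
        (auto simp: sibling_traversal_def side.simps length_subtree_traversal set_subtree_traversal
          verts_rooted_sibling_tree)
  qed
qed

lemma distinct_infix_positions:
  assumes "distinct (xs @ L @ ys)"
  shows "{i. i < length (xs @ L @ ys) \<and> (xs @ L @ ys) ! i \<in> set L} = {length xs..<length xs + length L}"
proof -
  have "(xs @ L @ ys) ! i \<in> set L \<longleftrightarrow> length xs \<le> i \<and> i < length xs + length L"
    if i: "i < length (xs @ L @ ys)" for i
  proof -
    consider "i < length xs" | "length xs \<le> i" "i < length xs + length L" | "length xs + length L \<le> i"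
      by linarith
    then show ?thesis
    proof cases
      case 1
      then have "(xs @ L @ ys) ! i \<in> set xs" by (simp add: nth_append)
      then show ?thesis using assms 1 by auto
    next
      case 2
      then have "i - length xs < length L" by linarith
      then show ?thesis using 2 by (simp add: nth_append)
    next
      case 3
      then have "\<not> i < length xs" "\<not> i - length xs < length L" by linarith+
      then have "(xs @ L @ ys) ! i = ys ! (i - length xs - length L)"
        by (simp add: nth_append)
      then have "(xs @ L @ ys) ! i \<in> set ys" using 3 i by simp
      then show ?thesis using assms 3 by auto
    qed
  qed
  then show ?thesis by auto
qed

lemma cut_interval:
  assumes "c \<in> cuts n"
  obtains s where "{x \<in> {1..2 ^ n}. sibling_tree_vertex n x \<in> side c} = {Suc s..<Suc s + cut_size n c}"
proof -
  let ?l = "sibling_traversal n"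
  obtain xs L ys where L: "?l = xs @ L @ ys" "set L = side c \<inter> verts (rooted_sibling_tree n)"
      "length L = cut_size n c"
    using cut_infix[OF assms] by blast
  have dist: "distinct ?l"
    by (auto simp: sibling_traversal_def distinct_map distinct_subtree_traversal)
  have len: "length ?l = 2 ^ n"
    by (simp add: sibling_traversal_def length_subtree_traversal)
  have "set ?l = verts (rooted_sibling_tree n)"
    by (auto simp: sibling_traversal_def set_subtree_traversal verts_rooted_sibling_tree)
  then have "?l ! i \<in> set L \<longleftrightarrow> ?l ! i \<in> side c" if "i < 2 ^ n" for i
    using L(2) len that nth_mem by force
  then have pos: "{i. i < 2 ^ n \<and> ?l ! i \<in> side c} = {length xs..<length xs + cut_size n c}"
    using distinct_infix_positions[of xs L ys] dist len L(1,3) by auto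
  have "{x \<in> {1..2 ^ n}. sibling_tree_vertex n x \<in> side c} = Suc ` {i. i < 2 ^ n \<and> ?l ! i \<in> side c}"
    by (auto simp: sibling_tree_vertex_def image_iff Suc_le_eq gr0_conv_Suc)
  then show thesis
    using that[of "length xs"] unfolding pos by simp
qed

lemma card_preimage:
  assumes "bij_betw h W U"
  shows "card {v \<in> W. h v \<in> C} = card (C \<inter> U)"
proof (rule bij_betw_same_card)
  show "bij_betw h {v \<in> W. h v \<in> C} (C \<inter> U)"
    using assms by (auto simp: bij_betw_def inj_on_def)
qed

text \<open>Every bijection puts the same number of vertices on the side of a cut, so embeddings differ only in
  how these vertices are distributed over the parts.\<close>

lemma card_preimage_side:
  assumes "c \<in> cuts n" and g: "bij_betw g V (verts (rooted_sibling_tree n))"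
  shows "card {v \<in> V. g v \<in> side c} = cut_size n c"
proof -
  obtain s where s: "{x \<in> {1..2 ^ n}. sibling_tree_vertex n x \<in> side c} = {Suc s..<Suc s + cut_size n c}"
    using cut_interval[OF assms(1)] .
  have "card {v \<in> V. g v \<in> side c} = card (side c \<inter> verts (rooted_sibling_tree n))"
    using g by (rule card_preimage)
  also have "\<dots> = card {x \<in> {1..2 ^ n}. sibling_tree_vertex n x \<in> side c}"
    using bij_betw_sibling_tree_vertex by (rule card_preimage[symmetric])
  finally show ?thesis unfolding s by simp
qed

section \<open>The wirelength as a sum of boundaries\<close>

lemma finite_edges:
  assumes "simple_graph G"
  shows "finite (edges G)"
proof (rule finite_subset)
  show "edges G \<subseteq> Pow (verts G)" using assms by (fastforce simp: simple_graph_def)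
  show "finite (Pow (verts G))" using assms by (simp add: simple_graph_def)
qed

lemma edge_endpoints:
  assumes "simple_graph G" "{a, b} \<in> edges G"
  shows "a \<in> verts G" "b \<in> verts G"
proof -
  obtain u v where "u \<in> verts G" "v \<in> verts G" "{a, b} = {u, v}"
    using assms unfolding simple_graph_def by blast
  then show "a \<in> verts G" "b \<in> verts G" by (auto simp: doubleton_eq_iff)
qed

lemma separating_image_edge:
  assumes "simple_graph G" "{a, b} \<in> edges G"
  shows "separating n (g a) (g b) = {c \<in> cuts n. {a, b} \<in> boundary G {v \<in> verts G. g v \<in> side c}}"
  using assms(2) edge_endpoints[OF assms] by (auto simp: separating_def boundary_def)

text \<open>Double counting of the pairs of a cut and an edge of \<open>G\<close> whose image it separates.\<close>

lemma sum_card_boundary: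
  assumes "simple_graph G"
  shows "(\<Sum>c\<in>cuts n. card (boundary G {v \<in> verts G. g v \<in> side c})) =
    (\<Sum>e\<in>edges G. card {c \<in> cuts n. e \<in> boundary G {v \<in> verts G. g v \<in> side c}})"
proof -
  have "{e \<in> edges G. e \<in> boundary G S} = boundary G S" for S
    by (auto simp: boundary_def)
  then show ?thesis
    using sum_multicount_gen[OF finite_edges[OF assms] finite_cuts[of n],
        of "\<lambda>e c. e \<in> boundary G {v \<in> verts G. g v \<in> side c}"
          "\<lambda>c. card (boundary G {v \<in> verts G. g v \<in> side c})"]
    by simp
qed

lemma sum_card_boundary_le:
  assumes G: "simple_graph G" and n: "n \<ge> 1" and emb: "embedding G (rooted_sibling_tree n) g Q"
  shows "(\<Sum>c\<in>cuts n. card (boundary G {v \<in> verts G. g v \<in> side c})) \<le> 2 * embedding_wirelength G Q"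
  unfolding sum_card_boundary[OF G] embedding_wirelength_def sum_distrib_left
proof (rule sum_mono)
  fix e assume e: "e \<in> edges G"
  then obtain a b where ab: "e = {a, b}" using G unfolding simple_graph_def by blast
  then have "path_between (rooted_sibling_tree n) (g a) (g b) (Q e)"
    using emb e by (simp add: embedding_def)
  from card_separating_le_path[OF n this]
  show "card {c \<in> cuts n. e \<in> boundary G {v \<in> verts G. g v \<in> side c}} \<le> 2 * path_length (Q e)"
    using separating_image_edge[OF G, of a b n g] e ab by simp
qed

lemma sum_card_boundary_eq:
  assumes G: "simple_graph G" and n: "n \<ge> 1"
    and f: "f ` verts G \<subseteq> verts (rooted_sibling_tree n)"
    and P: "\<And>a b. {a, b} \<in> edges G \<Longrightarrow>
      shortest_path_between (rooted_sibling_tree n) (f a) (f b) (P {a, b})"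
  shows "(\<Sum>c\<in>cuts n. card (boundary G {v \<in> verts G. f v \<in> side c})) = 2 * embedding_wirelength G P"
  unfolding sum_card_boundary[OF G] embedding_wirelength_def sum_distrib_left
proof (rule sum.cong[OF refl])
  fix e assume e: "e \<in> edges G"
  then obtain a b where ab: "e = {a, b}" using G unfolding simple_graph_def by blast
  then have ed: "{a, b} \<in> edges G" using e by simp
  have "f a \<in> verts (rooted_sibling_tree n)" "f b \<in> verts (rooted_sibling_tree n)"
    using edge_endpoints[OF G ed] f by auto
  from shortest_path_iff[OF n this] P[OF ed]
  show "card {c \<in> cuts n. e \<in> boundary G {v \<in> verts G. f v \<in> side c}} = 2 * path_length (P e)"
    unfolding ab separating_image_edge[OF G ed] by simp
qed

text \<open>The paths are indexed by unordered edges, so one list has to serve for both orientations of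
  an edge.\<close>

lemma ex_shortest_paths:
  assumes G: "simple_graph G" and n: "n \<ge> 1"
    and f: "f ` verts G \<subseteq> verts (rooted_sibling_tree n)"
  shows "\<exists>P. \<forall>a b. {a, b} \<in> edges G \<longrightarrow>
    shortest_path_between (rooted_sibling_tree n) (f a) (f b) (P {a, b})"
proof -
  have "\<exists>q. \<forall>a b. e = {a, b} \<longrightarrow> shortest_path_between (rooted_sibling_tree n) (f a) (f b) q"
    if e: "e \<in> edges G" for e
  proof -
    obtain a b where ab: "e = {a, b}" using G e unfolding simple_graph_def by blast
    then have "f a \<in> verts (rooted_sibling_tree n)" "f b \<in> verts (rooted_sibling_tree n)"
      using edge_endpoints[OF G, of a b] e f by auto
    then obtain q where q: "shortest_path_between (rooted_sibling_tree n) (f a) (f b) q"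
      using ex_shortest_path[OF n] by blast
    have "shortest_path_between (rooted_sibling_tree n) (f a') (f b') q" if "e = {a', b'}" for a' b'
    proof -
      have "a = a' \<and> b = b' \<or> a = b' \<and> b = a'" using that ab by (auto simp: doubleton_eq_iff)
      then show ?thesis
        using q shortest_path_between_commute[of "rooted_sibling_tree n" "f a" "f b"] by auto
    qed
    then show ?thesis by blast
  qed
  then obtain P where "\<And>e a b. e \<in> edges G \<Longrightarrow> e = {a, b} \<Longrightarrow>
      shortest_path_between (rooted_sibling_tree n) (f a) (f b) (P e)"
    by metis
  then show ?thesis by blast
qed

section \<open>Evaluation of the sum over the cuts\<close>

lemma sum_by_length:
  fixes \<phi> :: "nat \<Rightarrow> real"
  shows "(\<Sum>w | length (w :: bool list) < N. \<phi> (length w)) = (\<Sum>d<N. 2 ^ d * \<phi> d)"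
proof (induction N)
  case (Suc N)
  have fin: "finite {w :: bool list. length w = N}"
    by (rule finite_subset[OF _ finite_short_bool_lists[of "Suc N"]]) auto
  have card: "card {w :: bool list. length w = N} = 2 ^ N"
    using card_lists_length_eq[of "UNIV :: bool set" N] by simp
  have "{w :: bool list. length w < Suc N} = {w. length w < N} \<union> {w. length w = N}" by auto
  then have "(\<Sum>w | length (w :: bool list) < Suc N. \<phi> (length w))
      = (\<Sum>w | length (w :: bool list) < N. \<phi> (length w)) + (\<Sum>w | length (w :: bool list) = N. \<phi> (length w))"
    using finite_short_bool_lists[of N] fin by (simp only:) (rule sum.union_disjoint; auto)
  then show ?case using Suc card by simp
qed simp

text \<open>The three summands come from the branches, ordered by the height \<open>j\<close> of the subtree, from the
  offspring cuts, ordered by the height \<open>j\<close> of the two subtrees split off, and from the pendant cut.\<close>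

lemma sum_cut_sizes:
  fixes \<phi> :: "nat \<Rightarrow> real"
  shows "(\<Sum>c\<in>cuts n. \<phi> (cut_size n c)) = (\<Sum>j = 1..n. 2 ^ (n - j) * \<phi> (2 ^ j - 1))
    + (\<Sum>j = 1..n - 1. 2 ^ (n - j - 1) * \<phi> (2 ^ (j + 1) - 2)) + \<phi> (2 ^ n - 1)"
proof -
  let ?B = "{w :: bool list. length w < n}" and ?O = "{w :: bool list. length w < n - 1}"
  have cuts: "cuts n = (Branch ` ?B \<union> Offspring ` ?O) \<union> {Pendant}"
    by (auto simp: cuts_def)
  have "(\<Sum>c\<in>cuts n. \<phi> (cut_size n c)) = (\<Sum>c\<in>Branch ` ?B. \<phi> (cut_size n c))
      + (\<Sum>c\<in>Offspring ` ?O. \<phi> (cut_size n c)) + \<phi> (2 ^ n - 1)"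
    unfolding cuts
    by (subst sum.union_disjoint, use finite_short_bool_lists in auto)
      (subst sum.union_disjoint, use finite_short_bool_lists in auto)
  also have "(\<Sum>c\<in>Branch ` ?B. \<phi> (cut_size n c)) = (\<Sum>w\<in>?B. \<phi> (2 ^ (n - length w) - 1))"
    by (subst sum.reindex) (auto simp: inj_on_def)
  also have "\<dots> = (\<Sum>d<n. 2 ^ d * \<phi> (2 ^ (n - d) - 1))"
    by (rule sum_by_length)
  also have "\<dots> = (\<Sum>j = 1..n. 2 ^ (n - j) * \<phi> (2 ^ j - 1))"
    by (rule sum.reindex_bij_witness[of _ "\<lambda>j. n - j" "\<lambda>d. n - d"]) auto
  also have "(\<Sum>c\<in>Offspring ` ?O. \<phi> (cut_size n c)) = (\<Sum>w\<in>?O. \<phi> (2 ^ (n - length w) - 2))"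
    by (subst sum.reindex) (auto simp: inj_on_def)
  also have "\<dots> = (\<Sum>d<n - 1. 2 ^ d * \<phi> (2 ^ (n - d) - 2))"
    by (rule sum_by_length)
  also have "\<dots> = (\<Sum>j = 1..n - 1. 2 ^ (n - j - 1) * \<phi> (2 ^ (j + 1) - 2))"
    by (rule sum.reindex_bij_witness[of _ "\<lambda>j. n - j - 1" "\<lambda>d. n - d - 1"])
      (auto simp: Suc_diff_Suc)
  finally show ?thesis .
qed

lemma div_below_multiple:
  fixes m i t :: nat
  assumes "0 < i" "i \<le> m"
  shows "(Suc t * m - i) div m = t"
proof (rule div_nat_eqI)
  have m: "Suc t * m = m * t + m" by (simp add: mult.commute)
  show "m * t \<le> Suc t * m - i" using assms unfolding m by linarith
  show "Suc t * m - i < m * Suc t" using assms unfolding m by simp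
qed

text \<open>For \<open>j \<le> p\<close> a balanced set of this size has at most one vertex in each part; for \<open>j > p\<close> it has
  \<open>2 ^ (j - p)\<close> vertices in each part except one, which has one less.\<close>

lemma balanced_boundary_c_term:
  assumes "p \<le> n"
  shows "real_of_int (balanced_boundary n p (2 ^ j - 1)) = c_term n p j"
proof -
  have N: "(2 :: real) ^ n = 2 ^ (n - p) * 2 ^ p"
    using assms by (simp flip: power_add)
  have k: "real (2 ^ j - 1) = 2 ^ j - 1" by simp
  show ?thesis
  proof (cases "j \<le> p")
    case True
    have "(2::nat) ^ j \<le> 2 ^ p" using True by (simp add: power_increasing)
    then have q: "(2 ^ j - 1) div 2 ^ p = (0::nat)"
      by (intro div_less) (simp add: less_le_trans[OF diff_less])
    show ?thesis
      using True
      by (simp only: balanced_boundary_def c_term_def Let_def q N of_int_add of_int_diff of_int_mult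
          of_int_power of_int_numeral of_int_of_nat_eq of_int_1 of_nat_0 of_int_0 k if_True)
        (simp add: algebra_simps)
  next
    case False
    then have j: "(2::nat) ^ j = 2 ^ (j - p) * 2 ^ p" "(2::real) ^ j = 2 ^ (j - p) * 2 ^ p"
      by (simp_all flip: power_add)
    obtain t where t: "(2::nat) ^ (j - p) = Suc t" by (metis gr0_implies_Suc zero_less_numeral zero_less_power)
    have "(2 ^ j - 1) div 2 ^ p = t"
      unfolding j t by (rule div_below_multiple) simp_all
    moreover have "real t = 2 ^ (j - p) - 1"
      using arg_cong[OF t, of real] by simp
    ultimately have q: "real ((2 ^ j - 1) div 2 ^ p) = 2 ^ (j - p) - 1" by simp
    show ?thesis
      using False
      by (simp only: balanced_boundary_def c_term_def Let_def q N of_int_add of_int_diff of_int_mult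
          of_int_power of_int_numeral of_int_of_nat_eq of_int_1 k j(2) if_False)
        (simp add: algebra_simps)
  qed
qed

text \<open>For \<open>j + 1 > p\<close> a balanced set of this size has one vertex less in two of the parts than in
  the others, so there must be at least two parts.\<close>

lemma balanced_boundary_s_term:
  assumes "p \<ge> 1" "p \<le> n"
  shows "real_of_int (balanced_boundary n p (2 ^ (j + 1) - 2)) = s_term n p j"
proof -
  have N: "(2 :: real) ^ n = 2 ^ (n - p) * 2 ^ p"
    using assms(2) by (simp flip: power_add)
  have "(2::nat) \<le> 2 ^ (j + 1)" by simp
  then have k: "real (2 ^ (j + 1) - 2) = 2 * 2 ^ j - 2" by simp
  show ?thesis
  proof (cases "j + 1 \<le> p")
    case True
    have "(2::nat) ^ (j + 1) \<le> 2 ^ p" using True by (intro power_increasing) auto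
    then have q: "(2 ^ (j + 1) - 2) div 2 ^ p = (0::nat)"
      using \<open>(2::nat) \<le> 2 ^ (j + 1)\<close> by (intro div_less) linarith
    show ?thesis
      using True
      by (simp only: balanced_boundary_def s_term_def Let_def q N of_int_add of_int_diff of_int_mult
          of_int_power of_int_numeral of_int_of_nat_eq of_int_1 of_nat_0 of_int_0 k if_True)
        (simp add: algebra_simps)
  next
    case False
    then have j: "(2::nat) ^ (j + 1) = 2 ^ (j + 1 - p) * 2 ^ p"
        "(2::real) ^ j = 2 ^ (j - p) * 2 ^ p"
      by (simp_all only: power_add[symmetric]) simp_all
    obtain t where t: "(2::nat) ^ (j + 1 - p) = Suc t"
      by (metis gr0_implies_Suc zero_less_numeral zero_less_power)
    have p2: "(2::nat) \<le> 2 ^ p" using power_increasing[OF assms(1), of "2::nat"] by simp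
    then have "(2 ^ (j + 1) - 2) div 2 ^ p = t"
      unfolding j t by (intro div_below_multiple) simp_all
    moreover have "j + 1 - p = Suc (j - p)" using False by simp
    then have "real t = 2 * 2 ^ (j - p) - 1"
      using arg_cong[OF t, of real] by simp
    ultimately have q: "real ((2 ^ (j + 1) - 2) div 2 ^ p) = 2 * 2 ^ (j - p) - 1" by simp
    show ?thesis
      using False
      by (simp only: balanced_boundary_def s_term_def Let_def q N of_int_add of_int_diff of_int_mult
          of_int_power of_int_numeral of_int_of_nat_eq of_int_1 k if_False)
        (simp add: power_add j(2) algebra_simps)
  qed
qed

section \<open>Minimality and the value of the wirelength\<close>

theorem mainTheorem3:
  fixes n p :: nat
    and G :: "'a graph" and Ps :: "'a set set" and lab :: "'a \<Rightarrow> nat"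
    and f :: "'a \<Rightarrow> bool list option"
  assumes "p \<ge> 2" and "n \<ge> 2" and "p \<le> n"
    and "complete_multipartite G Ps"
    and "card Ps = 2 ^ p" and "\<And>A. A \<in> Ps \<Longrightarrow> card A = 2 ^ (n - p)"
    and "bij_betw lab (verts G) {1..2 ^ n}"
    and "Ps = (\<lambda>r. {v \<in> verts G. lab v mod 2 ^ p = r}) ` {0..<2 ^ p}"
    and "\<And>v. v \<in> verts G \<Longrightarrow> f v = sibling_tree_vertex n (lab v)"
  shows "(\<exists>P. \<forall>a b. {a, b} \<in> edges G \<longrightarrow>
            shortest_path_between (rooted_sibling_tree n) (f a) (f b) (P {a, b})) \<and>
    (\<forall>P. (\<forall>a b. {a, b} \<in> edges G \<longrightarrow>
            shortest_path_between (rooted_sibling_tree n) (f a) (f b) (P {a, b})) \<longrightarrow>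
          embedding G (rooted_sibling_tree n) f P \<and>
          (\<forall>g Q. embedding G (rooted_sibling_tree n) g Q \<longrightarrow>
            embedding_wirelength G P \<le> embedding_wirelength G Q)) \<and>
    real (wirelength G (rooted_sibling_tree n)) =
      1 / 2 * (\<Sum>j = 1..n. \<Sum>i = 1..(2::nat) ^ (n - j). c_term n p j) +
      1 / 2 * (\<Sum>j = 1..n - 1. \<Sum>i = 1..(2::nat) ^ (n - j - 1). s_term n p j) +
      2 powi (int n - int p - 1) * (2 ^ p - 1)"
proof -
  let ?H = "rooted_sibling_tree n" and ?W = "\<Sum>c\<in>cuts n. balanced_boundary n p (cut_size n c)"
  note p = \<open>p \<ge> 2\<close> and multi = \<open>complete_multipartite G Ps\<close> and lab = \<open>bij_betw lab (verts G) {1..2 ^ n}\<close>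
  have n: "n \<ge> 1" using \<open>n \<ge> 2\<close> by simp
  have fin: "finite (verts G)" using bij_betw_finite[OF lab] by simp
  have order: "card (verts G) = 2 ^ n" using bij_betw_same_card[OF lab] by simp
  have simple: "simple_graph G" using complete_multipartite_simple_graph[OF multi fin] .
  have orderH: "card (verts ?H) = 2 ^ n"
    using bij_betw_same_card[OF bij_betw_sibling_tree_vertex, of n] by simp
  have finH: "finite (verts ?H)" using rooted_sibling_tree_simple_graph[OF n] by (simp add: simple_graph_def)
  have "bij_betw (sibling_tree_vertex n \<circ> lab) (verts G) (verts ?H)"
    using lab bij_betw_sibling_tree_vertex by (rule bij_betw_trans)
  then have f: "bij_betw f (verts G) (verts ?H)"
    using assms(9) by (subst bij_betw_cong[where g = "sibling_tree_vertex n \<circ> lab"]) simp_all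

  \<comment> \<open>The lower bound holds for every embedding, as each cut side has its minimal boundary in \<open>?W\<close>.\<close>
  have lower: "?W \<le> 2 * int (embedding_wirelength G Q)" if emb: "embedding G ?H g Q" for g Q
  proof -
    have "inj_on g (verts G)" "g ` verts G \<subseteq> verts ?H" using emb by (simp_all add: embedding_def)
    then have g: "bij_betw g (verts G) (verts ?H)"
      unfolding bij_betw_def using card_subset_eq[OF finH] order orderH by (simp add: card_image)
    have "?W \<le> (\<Sum>c\<in>cuts n. int (card (boundary G {v \<in> verts G. g v \<in> side c})))"
    proof (rule sum_mono)
      fix c assume "c \<in> cuts n"
      from card_preimage_side[OF this g]
      show "balanced_boundary n p (cut_size n c) \<le> int (card (boundary G {v \<in> verts G. g v \<in> side c}))"
        using balanced_boundary_le[OF multi fin order assms(5,6), of "{v \<in> verts G. g v \<in> side c}"]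
        by simp
    qed
    also have "\<dots> = int (\<Sum>c\<in>cuts n. card (boundary G {v \<in> verts G. g v \<in> side c}))" by simp
    also have "\<dots> \<le> int (2 * embedding_wirelength G Q)"
      using sum_card_boundary_le[OF simple n emb] by (simp only: of_nat_le_iff)
    finally show ?thesis by simp
  qed

  \<comment> \<open>For \<open>f\<close> the side of a cut is an interval of labels and meets the residue classes evenly.\<close>
  have balanced: "int (card (boundary G {v \<in> verts G. f v \<in> side c})) = balanced_boundary n p (cut_size n c)"
    if c: "c \<in> cuts n" for c
  proof -
    let ?S = "{v \<in> verts G. f v \<in> side c}"
    obtain s where s: "{x \<in> {1..2 ^ n}. sibling_tree_vertex n x \<in> side c} = {Suc s..<Suc s + cut_size n c}"
      using cut_interval[OF c] .
    have size: "card ?S = cut_size n c" using card_preimage_side[OF c f] .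
    have "card (?S \<inter> A) \<in> {card ?S div 2 ^ p, card ?S div 2 ^ p + 1}" if A: "A \<in> Ps" for A
    proof -
      obtain r where r: "r < 2 ^ p" "A = {v \<in> verts G. lab v mod 2 ^ p = r}"
        using A unfolding assms(8) by auto
      have "?S \<inter> A = {v \<in> verts G. lab v \<in> {x \<in> {Suc s..<Suc s + cut_size n c}. x mod 2 ^ p = r}}"
        unfolding s[symmetric] r(2) using assms(9) bij_betwE[OF lab] by auto
      then have "card (?S \<inter> A) = card ({x \<in> {Suc s..<Suc s + cut_size n c}. x mod 2 ^ p = r} \<inter> {1..2 ^ n})"
        using card_preimage[OF lab] by (simp only:)
      also have "\<dots> = card {x \<in> {Suc s..<Suc s + cut_size n c}. x mod 2 ^ p = r}"
        unfolding s[symmetric] by (rule arg_cong[where f = card]) blast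
      finally show ?thesis
        unfolding size using card_residue_interval[OF r(1)] by (simp only:)
    qed
    then show ?thesis
      using balanced_boundary_eq[OF multi fin order assms(5,6), of ?S] size by simp
  qed

  have f_sub: "f ` verts G \<subseteq> verts ?H" using f by (simp add: bij_betw_def)
  have exact: "embedding G ?H f P \<and> 2 * int (embedding_wirelength G P) = ?W"
    if P: "\<forall>a b. {a, b} \<in> edges G \<longrightarrow> shortest_path_between ?H (f a) (f b) (P {a, b})" for P
  proof
    show "embedding G ?H f P"
      using P f by (auto simp: embedding_def bij_betw_def shortest_path_between_def)
    have "2 * int (embedding_wirelength G P)
        = int (\<Sum>c\<in>cuts n. card (boundary G {v \<in> verts G. f v \<in> side c}))"
      using sum_card_boundary_eq[OF simple n f_sub, of P] P by simp
    also have "\<dots> = (\<Sum>c\<in>cuts n. int (card (boundary G {v \<in> verts G. f v \<in> side c})))" by simp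
    also have "\<dots> = ?W" using balanced by (rule sum.cong[OF refl])
    finally show "2 * int (embedding_wirelength G P) = ?W" .
  qed

  have minimal: "embedding_wirelength G P \<le> embedding_wirelength G Q"
    if "\<forall>a b. {a, b} \<in> edges G \<longrightarrow> shortest_path_between ?H (f a) (f b) (P {a, b})"
      and "embedding G ?H g Q" for P g Q
    using exact[OF that(1)] lower[OF that(2)] by linarith

  obtain P where P: "\<forall>a b. {a, b} \<in> edges G \<longrightarrow> shortest_path_between ?H (f a) (f b) (P {a, b})"
    using ex_shortest_paths[OF simple n f_sub] by blast
  have "wirelength G ?H = embedding_wirelength G P"
    unfolding wirelength_def
  proof (rule Least_equality)
    show "\<exists>g Q. embedding G ?H g Q \<and> embedding_wirelength G P = embedding_wirelength G Q"
      using exact[OF P] by blast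
  qed (use minimal[OF P] in blast)
  then have "2 * int (wirelength G ?H) = ?W" using exact[OF P] by simp
  then have "2 * real (wirelength G ?H) = real_of_int ?W" by linarith
  also have "\<dots> = (\<Sum>c\<in>cuts n. real_of_int (balanced_boundary n p (cut_size n c)))" by simp
  also have "\<dots> = (\<Sum>j = 1..n. 2 ^ (n - j) * c_term n p j) + (\<Sum>j = 1..n - 1. 2 ^ (n - j - 1) * s_term n p j)
      + real_of_int (balanced_boundary n p (2 ^ n - 1))"
    unfolding sum_cut_sizes[of "\<lambda>k. real_of_int (balanced_boundary n p k)"]
    using balanced_boundary_c_term[OF \<open>p \<le> n\<close>] balanced_boundary_s_term[OF _ \<open>p \<le> n\<close>] p
    by (intro arg_cong2[where f = "(+)"] sum.cong refl) simp_all
  also have "real_of_int (balanced_boundary n p (2 ^ n - 1)) = 2 ^ (n - p) * (2 ^ p - 1)"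
    unfolding balanced_boundary_c_term[OF \<open>p \<le> n\<close>] using \<open>p \<le> n\<close>
    by (cases "n = p") (simp_all add: c_term_def algebra_simps)
  also have "(2::real) ^ (n - p) = 2 * 2 powi (int n - int p - 1)"
    using \<open>p \<le> n\<close> by (simp add: power_int_diff power_diff)
  finally have "real (wirelength G ?H) =
      1 / 2 * (\<Sum>j = 1..n. \<Sum>i = 1..(2::nat) ^ (n - j). c_term n p j) +
      1 / 2 * (\<Sum>j = 1..n - 1. \<Sum>i = 1..(2::nat) ^ (n - j - 1). s_term n p j) +
      2 powi (int n - int p - 1) * (2 ^ p - 1)"
    by simp
  then show ?thesis using P exact minimal by blast
qed

end
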